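(* Let $\mathcal{N}$ be the class of finite nilpotent groups. Then the set $\{ d'(G) \mid G\in\mathcal{N}\}$ is dense in $[0,1]$.
   Context: All groups are finite. For a finite group $G$, $L(G)$ denotes the set (lattice) of all subgroups of $G$, $k'(G)$ denotes the number of conjugacy classes of subgroups of $G$ (orbits of $G$ acting on $L(G)$ by conjugation), and $d'(G)=\frac{k'(G)}{|L(G)|}$. *)

theory Defs
  imports "HOL-Analysis.Analysis" "HOL-Algebra.Generated_Groups" "HOL-Algebra.Group_Action"
begin

definition commutator_subgroup ::
    "('a, 'b) monoid_scheme \<Rightarrow> 'a set \<Rightarrow> 'a set \<Rightarrow> 'a set" where
  "commutator_subgroup G H K =
     generate G (\<Union>h \<in> H. \<Union>k \<in> K. {h \<otimes>\<^bsub>G\<^esub> k \<otimes>\<^bsub>G\<^esub> inv\<^bsub>G\<^esub> h \<otimes>\<^bsub>G\<^esub> inv\<^bsub>G\<^esub> k})"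

primrec lower_central_series :: "('a, 'b) monoid_scheme \<Rightarrow> nat \<Rightarrow> 'a set" where
  "lower_central_series G 0 = carrier G"
| "lower_central_series G (Suc n) =
     commutator_subgroup G (lower_central_series G n) (carrier G)"

locale nilpotent_group = group +
  assumes lower_central_series_trivial: "\<exists>n. lower_central_series G n = {\<one>}"

definition subgroup_lattice :: "('a, 'b) monoid_scheme \<Rightarrow> 'a set set" where
  "subgroup_lattice G = {H. subgroup H G}"

text \<open>That the map below is an action of \<open>G\<close> is
  \<open>group.action_by_conjugation_on_subgroups_set\<close>.\<close>

definition subgroup_classes :: "('a, 'b) monoid_scheme \<Rightarrow> 'a set set set" where
  "subgroup_classes G =
     orbits G (subgroup_lattice G)
       (\<lambda>g. \<lambda>H \<in> subgroup_lattice G. g <#\<^bsub>G\<^esub> H #>\<^bsub>G\<^esub> inv\<^bsub>G\<^esub> g)"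

definition k' :: "('a, 'b) monoid_scheme \<Rightarrow> nat" where
  "k' G = card (subgroup_classes G)"

definition d' :: "('a, 'b) monoid_scheme \<Rightarrow> real" where
  "d' G = real (k' G) / real (card (subgroup_lattice G))"

text \<open>A set of groups needs a fixed type of elements. Every finite group is isomorphic to one
  whose carrier is a set of natural numbers, and nilpotency and \<open>d'\<close> are invariant under
  isomorphism, so taking the elements from \<^typ>\<open>nat\<close> loses no value of \<open>d'\<close>.\<close>

definition finite_nilpotent_groups :: "nat monoid set" where
  "finite_nilpotent_groups = {G. nilpotent_group G \<and> finite (carrier G)}"

definition dense_in_set :: "'a::topological_space set \<Rightarrow> 'a set \<Rightarrow> bool" where
  "dense_in_set S X \<longleftrightarrow> S \<subseteq> X \<and> X \<subseteq> closure S"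

end

theory Submission
  imports Defs "HOL-Algebra.Weak_Morphisms" "HOL-Algebra.Multiplicative_Group"
    "HOL-Number_Theory.Cong"
begin

text \<open>For an odd prime \<open>p\<close> and \<open>m \<ge> 2\<close>, the modular group of order \<open>p^(m+1)\<close> has exactly \<open>p\<close>
  non-normal subgroups, and they form one conjugacy class. Since the number of all subgroups lies
  between \<open>m p\<close> and \<open>(m + 1) (p + 1)\<close>, the value of \<open>d'\<close> lies between \<open>1 - 1/m\<close> and
  \<open>1 - 1/(2 (m + 1))\<close>, uniformly in \<open>p\<close>. As \<open>d'\<close> is multiplicative on direct products of groups of
  coprime orders, for fixed \<open>m\<close> the products over the first \<open>n\<close> odd primes give values that
  start at \<open>1\<close>, tend to \<open>0\<close> and decrease in steps of at most \<open>1/m\<close>.\<close>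

section \<open>Conjugacy classes of subgroups\<close>

text \<open>Conjugates are written as images under inner automorphisms, free of the cosets and of
  the restriction to the lattice in the action. Isomorphisms and products then act on classes
  through plain images.\<close>

definition conj_class :: "('a, 'b) monoid_scheme \<Rightarrow> 'a set \<Rightarrow> 'a set set" where
  "conj_class G H = (\<lambda>g. (\<lambda>x. g \<otimes>\<^bsub>G\<^esub> x \<otimes>\<^bsub>G\<^esub> inv\<^bsub>G\<^esub> g) ` H) ` carrier G"

lemma subgroup_classes_eq: "subgroup_classes G = conj_class G ` subgroup_lattice G"
proof -
  have "g <#\<^bsub>G\<^esub> H #>\<^bsub>G\<^esub> inv\<^bsub>G\<^esub> g = (\<lambda>x. g \<otimes>\<^bsub>G\<^esub> x \<otimes>\<^bsub>G\<^esub> inv\<^bsub>G\<^esub> g) ` H" for g H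
    unfolding l_coset_def r_coset_def by blast
  then have "orbit G (\<lambda>g. \<lambda>H \<in> subgroup_lattice G. g <#\<^bsub>G\<^esub> H #>\<^bsub>G\<^esub> inv\<^bsub>G\<^esub> g) H = conj_class G H"
    if "H \<in> subgroup_lattice G" for H
    using that unfolding orbit_def conj_class_def by auto
  then show ?thesis
    unfolding subgroup_classes_def orbits_def by (auto simp: image_def)
qed

lemma finite_subgroup_lattice:
  assumes "finite (carrier G)"
  shows "finite (subgroup_lattice G)"
  by (rule finite_subset[of _ "Pow (carrier G)"])
    (auto simp: subgroup_lattice_def assms dest: subgroup.subset)

lemma d'_bounds:
  assumes "finite (carrier G)"
  shows "d' G \<in> {0..1}"
  using card_image_le[OF finite_subgroup_lattice[OF assms], of "conj_class G"]
  by (auto simp: d'_def k'_def subgroup_classes_eq divide_le_eq_1)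

text \<open>Locates the classes in a domain on which the twofold image of an injective map is
  injective, so that an isomorphism preserves their number.\<close>

lemma subgroup_classes_subset: "subgroup_classes G \<subseteq> Pow (Pow (carrier G))" if "group G"
proof -
  interpret group G by fact
  show ?thesis
    by (auto simp: subgroup_classes_eq conj_class_def subgroup_lattice_def dest!: subgroup.subset)
qed

section \<open>Invariance of \<open>d'\<close> under isomorphism\<close>

lemma image_subgroup_lattice_subset:
  assumes "group G" "group H" "f \<in> hom G H"
  shows "image f ` subgroup_lattice G \<subseteq> subgroup_lattice H"
proof -
  interpret group_hom G H f
    using assms by (simp add: group_hom_def group_hom_axioms_def)
  show ?thesis
    using subgroup_img_is_subgroup by (auto simp: subgroup_lattice_def)
qed

lemma subgroup_lattice_iso:
  assumes "group G" "group H" "f \<in> iso G H"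
  shows "subgroup_lattice H = image f ` subgroup_lattice G"
proof
  let ?g = "inv_into (carrier G) f"
  have hom: "f \<in> hom G H" and surj: "f ` carrier G = carrier H"
    using assms(3) by (auto simp: iso_def bij_betw_def)
  have "?g \<in> hom H G"
    using group.iso_set_sym[OF assms(1,3)] by (simp add: iso_def)
  note inv_img = image_subgroup_lattice_subset[OF assms(2,1) this]
  show "image f ` subgroup_lattice G \<subseteq> subgroup_lattice H"
    by (rule image_subgroup_lattice_subset[OF assms(1,2) hom])
  show "subgroup_lattice H \<subseteq> image f ` subgroup_lattice G"
  proof
    fix K assume K: "K \<in> subgroup_lattice H"
    then have "K \<subseteq> carrier H"
      unfolding subgroup_lattice_def by (simp add: subgroup.subset)
    then have "K = f ` ?g ` K"
      by (rule image_inv_into_cancel[OF surj, symmetric])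
    moreover have "?g ` K \<in> subgroup_lattice G"
      using inv_img K by blast
    ultimately show "K \<in> image f ` subgroup_lattice G" by (rule image_eqI)
  qed
qed

text \<open>Taking images under \<open>f\<close> is a bijection between the lattices and commutes
  with conjugation, so the numerator and the denominator both agree.\<close>

lemma d'_iso:
  fixes G (structure)
  assumes "group G" "group H" "f \<in> iso G H"
  shows "d' H = d' G"
proof -
  interpret group_hom G H f
    using assms by (simp add: group_hom_def group_hom_axioms_def iso_def)
  have inj: "inj_on f (carrier G)" and surj: "f ` carrier G = carrier H"
    using assms by (auto simp: iso_def bij_betw_def)
  have L: "subgroup_lattice H = image f ` subgroup_lattice G"
    by (rule subgroup_lattice_iso[OF assms])
  have conj: "conj_class H (f ` K) = image f ` conj_class G K" if K: "K \<in> subgroup_lattice G" for K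
  proof -
    have sub: "K \<subseteq> carrier G" using K by (auto simp: subgroup_lattice_def dest: subgroup.subset)
    show ?thesis
      unfolding conj_class_def surj[symmetric] image_image
      by (intro image_cong refl) (use sub in auto)
  qed
  have C: "subgroup_classes H = image (image f) ` subgroup_classes G"
    unfolding subgroup_classes_eq L image_image by (intro image_cong refl conj)
  have "card (subgroup_lattice H) = card (subgroup_lattice G)"
    unfolding L
    by (rule card_image[OF inj_on_subset[OF inj_on_image_Pow[OF inj]]])
      (auto simp: subgroup_lattice_def dest: subgroup.subset)
  moreover have "card (subgroup_classes H) = card (subgroup_classes G)"
    unfolding C
    by (rule card_image[OF inj_on_subset[OF inj_on_image_Pow[OF inj_on_image_Pow[OF inj]]
          subgroup_classes_subset[OF assms(1)]]])
  ultimately show ?thesis by (simp add: d'_def k'_def)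
qed

section \<open>Direct products of groups of coprime orders\<close>

text \<open>A suitable power of \<open>(x, y)\<close> isolates either component, so a subgroup
  contains the components of its elements and is the product of its intersections with the two
  factors.\<close>

lemma subgroup_lattice_DirProd_coprime:
  assumes "group G" "group H" and fin: "finite (carrier G)" "finite (carrier H)"
    and cop: "coprime (order G) (order H)"
  shows "subgroup_lattice (G \<times>\<times> H) = (\<lambda>(A, B). A \<times> B) ` (subgroup_lattice G \<times> subgroup_lattice H)"
proof -
  interpret G: group G by fact
  interpret H: group H by fact
  interpret GH: group "G \<times>\<times> H" by (rule DirProd_group[OF assms(1,2)])
  have pow: "(x, y) [^]\<^bsub>G \<times>\<times> H\<^esub> n = (x [^]\<^bsub>G\<^esub> n, y [^]\<^bsub>H\<^esub> n)" for x y and n :: nat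
    by (induction n) auto
  have Gpow: "x [^]\<^bsub>G\<^esub> (n mod order G) = x [^]\<^bsub>G\<^esub> n" if "x \<in> carrier G" for x and n :: nat
    using that G.pow_order_eq_1[OF that]
    by (metis G.nat_pow_mult G.nat_pow_one G.nat_pow_pow G.l_one G.nat_pow_closed mod_mult_div_eq mult.commute G.r_one)
  have Hpow: "x [^]\<^bsub>H\<^esub> (n mod order H) = x [^]\<^bsub>H\<^esub> n" if "x \<in> carrier H" for x and n :: nat
    using that H.pow_order_eq_1[OF that]
    by (metis H.nat_pow_mult H.nat_pow_one H.nat_pow_pow H.l_one H.nat_pow_closed mod_mult_div_eq mult.commute H.r_one)
  \<comment> \<open>Exponents matter only modulo the group order. Raising to the power
    \<open>m\<close> fixes the first component and kills the second; the power \<open>n\<close> does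
    the reverse.\<close>
  obtain m where m: "[m = 1] (mod order G)" "[m = 0] (mod order H)"
    using binary_chinese_remainder_nat[OF cop] by blast
  obtain n where n: "[n = 0] (mod order G)" "[n = 1] (mod order H)"
    using binary_chinese_remainder_nat[OF cop] by blast
  have "K \<in> (\<lambda>(A, B). A \<times> B) ` (subgroup_lattice G \<times> subgroup_lattice H)"
    if K: "subgroup K (G \<times>\<times> H)" for K
  proof -
    interpret K: subgroup K "G \<times>\<times> H" by fact
    have split: "(x, \<one>\<^bsub>H\<^esub>) \<in> K \<and> (\<one>\<^bsub>G\<^esub>, y) \<in> K" if xy: "(x, y) \<in> K" for x y
    proof -
      have c: "x \<in> carrier G" "y \<in> carrier H" using xy K.subset by auto
      have kpow: "(x, y) [^]\<^bsub>G \<times>\<times> H\<^esub> k \<in> K" for k :: nat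
        using xy K.one_closed by (induction k) (auto intro: K.m_closed simp del: mult_DirProd)
      have "x [^]\<^bsub>G\<^esub> m = x" "y [^]\<^bsub>H\<^esub> m = \<one>\<^bsub>H\<^esub>" "x [^]\<^bsub>G\<^esub> n = \<one>\<^bsub>G\<^esub>" "y [^]\<^bsub>H\<^esub> n = y"
        using c m n by (metis Gpow Hpow cong_def G.nat_pow_0 H.nat_pow_0 G.nat_pow_eone H.nat_pow_eone)+
      then show ?thesis using kpow[of m] kpow[of n] by (simp add: pow)
    qed
    have mul: "(x, y) \<in> K" if "(x, \<one>\<^bsub>H\<^esub>) \<in> K" "(\<one>\<^bsub>G\<^esub>, y) \<in> K" for x y
    proof -
      have "x \<in> carrier G" "y \<in> carrier H" using that K.subset by auto
      then show ?thesis using K.m_closed[OF that] by simp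
    qed
    let ?A = "{x. (x, \<one>\<^bsub>H\<^esub>) \<in> K}" and ?B = "{y. (\<one>\<^bsub>G\<^esub>, y) \<in> K}"
    have "K = ?A \<times> ?B"
      unfolding set_eq_iff split_paired_All mem_Sigma_iff mem_Collect_eq using split mul by blast
    moreover have "subgroup ?A G"
    proof (rule G.subgroupI)
      show sub: "?A \<subseteq> carrier G" using K.subset by auto
      show "?A \<noteq> {}" using K.one_closed by auto
      show "inv\<^bsub>G\<^esub> a \<in> ?A" if "a \<in> ?A" for a
      proof -
        have a: "a \<in> carrier G" using that sub by blast
        show ?thesis using K.m_inv_closed[of "(a, \<one>\<^bsub>H\<^esub>)"] that by (simp add: inv_DirProd[OF assms(1,2) a H.one_closed])
      qed
      show "a \<otimes>\<^bsub>G\<^esub> b \<in> ?A" if "a \<in> ?A" "b \<in> ?A" for a b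
        using K.m_closed[of "(a, \<one>\<^bsub>H\<^esub>)" "(b, \<one>\<^bsub>H\<^esub>)"] that by simp
    qed
    moreover have "subgroup ?B H"
    proof (rule H.subgroupI)
      show sub: "?B \<subseteq> carrier H" using K.subset by auto
      show "?B \<noteq> {}" using K.one_closed by auto
      show "inv\<^bsub>H\<^esub> a \<in> ?B" if "a \<in> ?B" for a
      proof -
        have a: "a \<in> carrier H" using that sub by blast
        show ?thesis using K.m_inv_closed[of "(\<one>\<^bsub>G\<^esub>, a)"] that by (simp add: inv_DirProd[OF assms(1,2) G.one_closed a])
      qed
      show "a \<otimes>\<^bsub>H\<^esub> b \<in> ?B" if "a \<in> ?B" "b \<in> ?B" for a b
        using K.m_closed[of "(\<one>\<^bsub>G\<^esub>, a)" "(\<one>\<^bsub>G\<^esub>, b)"] that by simp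
    qed
    ultimately have "(?A, ?B) \<in> subgroup_lattice G \<times> subgroup_lattice H" "K = (\<lambda>(A, B). A \<times> B) (?A, ?B)"
      by (simp_all add: subgroup_lattice_def)
    then show ?thesis by (rule rev_image_eqI)
  qed
  moreover have "subgroup (A \<times> B) (G \<times>\<times> H)" if "subgroup A G" "subgroup B H" for A B
    using DirProd_subgroups[OF assms(1) that(1) assms(2) that(2)] .
  ultimately show ?thesis
    by (intro equalityI subsetI) (auto simp: subgroup_lattice_def)
qed

text \<open>The two components of the conjugating element act on the two factors separately and vary
  independently.\<close>

lemma conj_class_DirProd:
  assumes "group G" "group H"
  shows "conj_class (G \<times>\<times> H) (A \<times> B) = (\<lambda>(X, Y). X \<times> Y) ` (conj_class G A \<times> conj_class H B)"
proof -
  have eq: "(\<lambda>x. (g, h) \<otimes>\<^bsub>G \<times>\<times> H\<^esub> x \<otimes>\<^bsub>G \<times>\<times> H\<^esub> inv\<^bsub>G \<times>\<times> H\<^esub> (g, h)) ` (A \<times> B) =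
      (\<lambda>x. g \<otimes>\<^bsub>G\<^esub> x \<otimes>\<^bsub>G\<^esub> inv\<^bsub>G\<^esub> g) ` A \<times> (\<lambda>x. h \<otimes>\<^bsub>H\<^esub> x \<otimes>\<^bsub>H\<^esub> inv\<^bsub>H\<^esub> h) ` B"
    if "g \<in> carrier G" "h \<in> carrier H" for g h
    using that by (auto simp: inv_DirProd[OF assms(1,2)] image_iff)
  have "conj_class (G \<times>\<times> H) (A \<times> B) = (\<lambda>(g, h). (\<lambda>x. g \<otimes>\<^bsub>G\<^esub> x \<otimes>\<^bsub>G\<^esub> inv\<^bsub>G\<^esub> g) ` A \<times>
      (\<lambda>x. h \<otimes>\<^bsub>H\<^esub> x \<otimes>\<^bsub>H\<^esub> inv\<^bsub>H\<^esub> h) ` B) ` (carrier G \<times> carrier H)"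
    unfolding conj_class_def carrier_DirProd
    by (intro image_cong refl, elim SigmaE) (simp only: split_conv eq)
  also have "\<dots> = (\<lambda>(X, Y). X \<times> Y) ` (conj_class G A \<times> conj_class H B)"
    unfolding conj_class_def by force
  finally show ?thesis .
qed

lemma d'_DirProd_coprime:
  assumes "group G" "group H" "finite (carrier G)" "finite (carrier H)"
    and "coprime (order G) (order H)"
  shows "d' (G \<times>\<times> H) = d' G * d' H"
proof -
  let ?t = "\<lambda>(A, B). A \<times> B"
  note L = subgroup_lattice_DirProd_coprime[OF assms]
  have ne: "X \<noteq> {}" if "group K" "X \<in> \<Union> (subgroup_classes K)"
    for X :: "'x set" and K :: "('x, 'y) monoid_scheme"
    using that by (auto simp: subgroup_classes_eq conj_class_def subgroup_lattice_def dest: subgroup.one_closed)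
  have neL: "X \<noteq> {}" if "X \<in> subgroup_lattice K"
    for X :: "'x set" and K :: "('x, 'y) monoid_scheme"
    using that by (auto simp: subgroup_lattice_def dest: subgroup.one_closed)
  have neC: "C \<noteq> {}" if "group K" "C \<in> subgroup_classes K"
    for C :: "'x set set" and K :: "('x, 'y) monoid_scheme"
    using that group.is_monoid[OF that(1)]
    by (auto simp: subgroup_classes_eq conj_class_def dest: monoid.one_closed)
  \<comment> \<open>A product of sets determines its factors only if these are nonempty. Subgroups,
    their conjugates and the classes all are, so both counts multiply.\<close>
  have inj_t: "inj_on ?t ((- {{}}) \<times> (- {{}}))"
    by (auto simp: inj_on_def times_eq_iff)
  have "card (subgroup_lattice (G \<times>\<times> H)) = card (subgroup_lattice G) * card (subgroup_lattice H)"
    unfolding L card_cartesian_product[symmetric]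
    by (rule card_image, rule inj_on_subset[OF inj_t]) (auto dest: neL)
  moreover have C: "subgroup_classes (G \<times>\<times> H) =
    (\<lambda>(C, D). ?t ` (C \<times> D)) ` (subgroup_classes G \<times> subgroup_classes H)"
  proof -
    have "subgroup_classes (G \<times>\<times> H) = (\<lambda>(A, B). ?t ` (conj_class G A \<times> conj_class H B)) `
        (subgroup_lattice G \<times> subgroup_lattice H)"
      unfolding subgroup_classes_eq L image_image
      by (intro image_cong refl, elim SigmaE)
        (simp add: conj_class_DirProd[OF assms(1,2)])
    also have "\<dots> = (\<lambda>(C, D). ?t ` (C \<times> D)) `
        (conj_class G ` subgroup_lattice G \<times> conj_class H ` subgroup_lattice H)"
      unfolding image_paired_Times[symmetric] image_image
      by (intro image_cong refl, elim SigmaE) simp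
    finally show ?thesis unfolding subgroup_classes_eq .
  qed
  have "inj_on (\<lambda>(C, D). ?t ` (C \<times> D)) (subgroup_classes G \<times> subgroup_classes H)"
  proof (rule inj_onI, clarify)
    fix C D C' D'
    assume *: "C \<in> subgroup_classes G" "D \<in> subgroup_classes H"
      "C' \<in> subgroup_classes G" "D' \<in> subgroup_classes H" "?t ` (C \<times> D) = ?t ` (C' \<times> D')"
    have sub: "C \<times> D \<subseteq> (- {{}}) \<times> (- {{}})" if "C \<in> subgroup_classes G" "D \<in> subgroup_classes H" for C D
      using ne[OF assms(1)] ne[OF assms(2)] that by blast
    have "C \<times> D = C' \<times> D'"
      by (rule inj_on_image_eq_iff[OF inj_t sub sub, THEN iffD1]) fact+
    then show "C = C' \<and> D = D'"
      using neC[OF assms(1)] neC[OF assms(2)] * by (auto simp: times_eq_iff)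
  qed
  then have "card (subgroup_classes (G \<times>\<times> H)) = card (subgroup_classes G) * card (subgroup_classes H)"
    unfolding C card_cartesian_product[symmetric] by (rule card_image)
  ultimately show ?thesis
    by (simp add: d'_def k'_def)
qed

section \<open>Groups of nilpotency class at most two\<close>

text \<open>Nilpotency of class at most two. Phrased without inverses, it transfers to products and
  homomorphic images at once.\<close>

definition class_two :: "('a, 'b) monoid_scheme \<Rightarrow> bool" where
  "class_two G \<longleftrightarrow> (\<forall>x \<in> carrier G. \<forall>y \<in> carrier G. \<exists>c \<in> carrier G.
     (\<forall>z \<in> carrier G. c \<otimes>\<^bsub>G\<^esub> z = z \<otimes>\<^bsub>G\<^esub> c) \<and> x \<otimes>\<^bsub>G\<^esub> y = c \<otimes>\<^bsub>G\<^esub> (y \<otimes>\<^bsub>G\<^esub> x))"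

text \<open>The element \<open>c\<close> of \<open>class_two\<close> is forced to be the commutator
  of \<open>x\<close> and \<open>y\<close>. Hence the first commutator term is central and the next
  one is trivial.\<close>

lemma class_two_imp_nilpotent:
  fixes G (structure)
  assumes "group G" "class_two G"
  shows "nilpotent_group G"
proof -
  interpret group G by fact
  \<comment> \<open>The centre of the group.\<close>
  define C where "C = {c \<in> carrier G. \<forall>z \<in> carrier G. c \<otimes> z = z \<otimes> c}"
  have C: "subgroup C G"
  proof (rule subgroupI)
    show "C \<subseteq> carrier G" "C \<noteq> {}" by (auto simp: C_def)
    show "inv c \<in> C" if "c \<in> C" for c
    proof -
      have "inv c \<otimes> z = z \<otimes> inv c" if z: "z \<in> carrier G" for z
      proof -
        have "c \<in> carrier G" "c \<otimes> z = z \<otimes> c" using z \<open>c \<in> C\<close> by (auto simp: C_def)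
        then have "inv c \<otimes> (z \<otimes> c) \<otimes> inv c = z \<otimes> inv c"
          using z by (metis inv_closed inv_solve_left m_closed)
        then show ?thesis
          using z \<open>c \<in> carrier G\<close> by (simp add: m_assoc)
      qed
      then show ?thesis using that by (simp add: C_def)
    qed
    show "c \<otimes> d \<in> C" if "c \<in> C" "d \<in> C" for c d
    proof -
      have cd: "c \<in> carrier G" "d \<in> carrier G" using that by (auto simp: C_def)
      have "c \<otimes> d \<otimes> z = z \<otimes> (c \<otimes> d)" if z: "z \<in> carrier G" for z
      proof -
        have "c \<otimes> d \<otimes> z = c \<otimes> (z \<otimes> d)" using cd z \<open>d \<in> C\<close> by (metis (mono_tags, lifting) C_def m_assoc mem_Collect_eq)
        also have "\<dots> = z \<otimes> c \<otimes> d" using cd z \<open>c \<in> C\<close> by (metis (mono_tags, lifting) C_def m_assoc mem_Collect_eq)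
        finally show ?thesis using cd z by (simp add: m_assoc)
      qed
      then show ?thesis using cd by (simp add: C_def)
    qed
  qed
  have "x \<otimes> y \<otimes> inv x \<otimes> inv y \<in> C" if xy: "x \<in> carrier G" "y \<in> carrier G" for x y
  proof -
    obtain c where c: "c \<in> C" "x \<otimes> y = c \<otimes> (y \<otimes> x)"
      using assms(2) xy unfolding class_two_def C_def by blast
    then have "x \<otimes> y \<otimes> inv x \<otimes> inv y = c"
      using xy subgroup.mem_carrier[OF C c(1)] by (simp add: m_assoc)
    then show ?thesis using c by simp
  qed
  then have sub: "lower_central_series G 1 \<subseteq> C"
    unfolding One_nat_def lower_central_series.simps commutator_subgroup_def
    by (intro generate_subgroup_incl[OF _ C]) blast
  \<comment> \<open>Ensures that the set of commutators generating the next term is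
    \<open>{\<one>}\<close> and not empty.\<close>
  have one: "\<one> \<in> lower_central_series G 1"
    by (auto simp: commutator_subgroup_def intro: generate.one)
  have "lower_central_series G 2 = generate G {\<one>}"
  proof -
    have "h \<otimes> k \<otimes> inv h \<otimes> inv k = \<one>" if "h \<in> lower_central_series G 1" "k \<in> carrier G" for h k
    proof -
      have h: "h \<in> carrier G" "h \<otimes> k = k \<otimes> h" using sub that by (auto simp: C_def)
      then show ?thesis using that by (simp add: m_assoc)
    qed
    then have "(\<Union>h \<in> lower_central_series G 1. \<Union>k \<in> carrier G. {h \<otimes> k \<otimes> inv h \<otimes> inv k}) = {\<one>}"
      using one by fastforce
    then show ?thesis by (simp add: numeral_2_eq_2 commutator_subgroup_def)
  qed
  then have "lower_central_series G 2 = {\<one>}" by (simp add: generate_one)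
  then show ?thesis
    by (intro nilpotent_group.intro nilpotent_group_axioms.intro exI is_group)
qed

lemma class_two_DirProd:
  assumes "class_two G" "class_two H"
  shows "class_two (G \<times>\<times> H)"
  unfolding class_two_def
proof (intro ballI)
  fix x y assume "x \<in> carrier (G \<times>\<times> H)" "y \<in> carrier (G \<times>\<times> H)"
  then have xy: "fst x \<in> carrier G" "snd x \<in> carrier H" "fst y \<in> carrier G" "snd y \<in> carrier H"
    by auto
  obtain c where c: "c \<in> carrier G" "\<forall>z \<in> carrier G. c \<otimes>\<^bsub>G\<^esub> z = z \<otimes>\<^bsub>G\<^esub> c"
      "fst x \<otimes>\<^bsub>G\<^esub> fst y = c \<otimes>\<^bsub>G\<^esub> (fst y \<otimes>\<^bsub>G\<^esub> fst x)"
    using assms(1) xy unfolding class_two_def by blast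
  obtain d where d: "d \<in> carrier H" "\<forall>z \<in> carrier H. d \<otimes>\<^bsub>H\<^esub> z = z \<otimes>\<^bsub>H\<^esub> d"
      "snd x \<otimes>\<^bsub>H\<^esub> snd y = d \<otimes>\<^bsub>H\<^esub> (snd y \<otimes>\<^bsub>H\<^esub> snd x)"
    using assms(2) xy unfolding class_two_def by blast
  show "\<exists>c \<in> carrier (G \<times>\<times> H). (\<forall>z \<in> carrier (G \<times>\<times> H). c \<otimes>\<^bsub>G \<times>\<times> H\<^esub> z = z \<otimes>\<^bsub>G \<times>\<times> H\<^esub> c) \<and>
      x \<otimes>\<^bsub>G \<times>\<times> H\<^esub> y = c \<otimes>\<^bsub>G \<times>\<times> H\<^esub> (y \<otimes>\<^bsub>G \<times>\<times> H\<^esub> x)"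
  proof (intro bexI conjI ballI)
    show "(c, d) \<in> carrier (G \<times>\<times> H)" using c d by simp
    show "(c, d) \<otimes>\<^bsub>G \<times>\<times> H\<^esub> z = z \<otimes>\<^bsub>G \<times>\<times> H\<^esub> (c, d)" if "z \<in> carrier (G \<times>\<times> H)" for z
      using that c(2) d(2) by (metis carrier_DirProd mem_Times_iff mult_DirProd prod.collapse)
    show "x \<otimes>\<^bsub>G \<times>\<times> H\<^esub> y = (c, d) \<otimes>\<^bsub>G \<times>\<times> H\<^esub> (y \<otimes>\<^bsub>G \<times>\<times> H\<^esub> x)"
      using c(3) d(3) by (metis mult_DirProd prod.collapse)
  qed
qed

lemma class_two_hom_image:
  fixes G (structure)
  assumes "group G" "f \<in> hom G H" "f ` carrier G = carrier H" "class_two G"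
  shows "class_two H"
  unfolding class_two_def assms(3)[symmetric]
proof (intro ballI; clarify)
  interpret group G by fact
  fix x y assume xy: "x \<in> carrier G" "y \<in> carrier G"
  obtain c where c: "c \<in> carrier G" "\<forall>z \<in> carrier G. c \<otimes>\<^bsub>G\<^esub> z = z \<otimes>\<^bsub>G\<^esub> c" "x \<otimes> y = c \<otimes> (y \<otimes> x)"
    using assms(4) xy unfolding class_two_def by blast
  show "\<exists>d \<in> f ` carrier G. (\<forall>z \<in> f ` carrier G. d \<otimes>\<^bsub>H\<^esub> z = z \<otimes>\<^bsub>H\<^esub> d) \<and>
      f x \<otimes>\<^bsub>H\<^esub> f y = d \<otimes>\<^bsub>H\<^esub> (f y \<otimes>\<^bsub>H\<^esub> f x)"
  proof (intro bexI conjI ballI)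
    show "f c \<in> f ` carrier G" using c by blast
    show "f c \<otimes>\<^bsub>H\<^esub> z = z \<otimes>\<^bsub>H\<^esub> f c" if "z \<in> f ` carrier G" for z
      using that c(1,2) by (metis hom_mult[OF assms(2)] imageE)
    show "f x \<otimes>\<^bsub>H\<^esub> f y = f c \<otimes>\<^bsub>H\<^esub> (f y \<otimes>\<^bsub>H\<^esub> f x)"
      using c(1,3) xy by (simp flip: hom_mult[OF assms(2)])
  qed
qed

text \<open>Direct products have pairs as elements, whereas \<open>finite_nilpotent_groups\<close>
  asks for natural numbers. A numbering of the carrier carries over everything that the construction
  keeps track of.\<close>

lemma class_two_nat_copy:
  fixes G :: "('a, 'b) monoid_scheme"
  assumes "group G" "finite (carrier G)" "class_two G"
  obtains H :: "nat monoid" where "group H" "finite (carrier H)" "class_two H"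
    "order H = order G" "d' H = d' G"
proof -
  interpret group G by fact
  obtain f :: "'a \<Rightarrow> nat" where f: "inj_on f (carrier G)"
    using finite_imp_inj_to_nat_seg[OF assms(2)] by blast
  define H where "H = image_group f G"
  have iso: "f \<in> iso G H"
    using f by (auto simp: iso_def hom_def H_def image_group_def bij_betw_def)
  have H: "group H"
    using iso_imp_img_group[OF iso] by (simp add: H_def image_group_def)
  show ?thesis
  proof
    show "group H" by fact
    show "finite (carrier H)" using assms(2) by (simp add: H_def image_group_carrier)
    show "class_two H"
      using iso by (intro class_two_hom_image[OF assms(1) _ _ assms(3), of f]) (auto simp: iso_def bij_betw_def)
    show "order H = order G"
      using f by (simp add: order_def H_def image_group_carrier card_image)
    show "d' H = d' G" by (rule d'_iso[OF assms(1) H iso])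
  qed
qed

section \<open>The modular groups\<close>

lemma (in group) subgroup_nat_pow_closed:
  assumes "subgroup H G" "h \<in> H"
  shows "h [^] (n :: nat) \<in> H"
  using subgroup_int_pow_closed[OF assms, of "int n"] by (simp add: int_pow_int)

text \<open>For an odd prime \<open>p\<close> and \<open>m \<ge> 2\<close> this is the modular \<open>p\<close>-group
  \<open>\<langle>x, y | x^(p^m) = y^p = 1, x y x^-1 y^-1 = x^(-p^(m-1))\<rangle>\<close> of order \<open>p^(m+1)\<close>, as a
  central extension of \<open>\<int>/p^m \<times> \<int>/p\<close> by a bilinear cocycle.\<close>

definition modular_group :: "nat \<Rightarrow> nat \<Rightarrow> (int \<times> int) monoid" where
  "modular_group p m = \<lparr>carrier = {0..<int p ^ m} \<times> {0..<int p},
     mult = (\<lambda>(a, b) (c, d). ((a + c + int p ^ (m - 1) * b * c) mod int p ^ m, (b + d) mod int p)),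
     one = (0, 0)\<rparr>"

section \<open>Arithmetic in the modular group\<close>

locale modular_p_group =
  fixes p m :: nat
  assumes prime_p: "prime p" and odd_p: "odd p" and m_ge_2: "m \<ge> 2"
begin

abbreviation "G \<equiv> modular_group p m"

definition "P = int p"
definition "q = P ^ m"
definition "r = P ^ (m - 1)"

text \<open>Elements are named by arbitrary integer representatives, so identities in the group
  become divisibility statements about integers.\<close>

definition red :: "int \<Rightarrow> int \<Rightarrow> int \<times> int" where
  "red a b = (a mod q, b mod P)"

lemma P_prime: "prime P" and P_gt_2: "P > 2"
  using prime_p odd_p prime_ge_2_nat[OF prime_p] by (auto simp: P_def order_le_less)

lemma q_pos: "q > 0"
  using P_gt_2 by (simp add: q_def)

lemma q_eq: "q = r * P"
  using m_ge_2 power_minus_mult[of m P] by (simp add: q_def r_def)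

lemma P_dvd_r: "P dvd r"
  using m_ge_2 by (simp add: r_def dvd_power)

text \<open>Depends on \<open>m \<ge> 2\<close>, through \<open>P dvd r\<close>. All terms quadratic
  in \<open>r\<close> vanish modulo \<open>q\<close>, which makes the later computations linear in
  \<open>r\<close>.\<close>

lemma q_dvd_rr: "q dvd r * r"
  unfolding q_eq by (rule mult_dvd_mono[OF dvd_refl P_dvd_r])

lemma power_dvd_q: "i \<le> m \<Longrightarrow> P ^ i dvd q"
  by (simp add: q_def le_imp_power_dvd)

lemma power_dvd_r: "i < m \<Longrightarrow> P ^ i dvd r"
  by (simp add: r_def le_imp_power_dvd)

lemma red_eq_iff: "red a b = red c d \<longleftrightarrow> q dvd a - c \<and> P dvd b - d"
  by (simp add: red_def mod_eq_dvd_iff)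

lemma red_mult: "red a b \<otimes>\<^bsub>G\<^esub> red c d = red (a + c + r * b * c) (b + d)"
proof -
  \<comment> \<open>The cocycle \<open>r * b * c\<close> is well defined: \<open>b\<close> is known
    only modulo \<open>P\<close>, but \<open>q = r * P\<close>.\<close>
  have "r * (b mod P) = (r * b) mod q"
    unfolding q_eq by (rule mult_mod_right)
  then have "r * (b mod P) mod q = r * b mod q"
    by (simp only: mod_mod_trivial)
  then have "(a mod q + c mod q + r * (b mod P) * (c mod q)) mod q = (a + c + r * b * c) mod q"
    by (rule mod_add_cong[OF mod_add_cong[OF mod_mod_trivial mod_mod_trivial]
          mod_mult_cong[OF _ mod_mod_trivial]])
  then show ?thesis
    unfolding red_def modular_group_def P_def[symmetric] r_def[symmetric] q_def[symmetric]
    by (simp add: mod_add_eq)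
qed

lemma one_eq: "\<one>\<^bsub>G\<^esub> = red 0 0"
  by (simp add: red_def modular_group_def)

lemma carrier_eq: "carrier G = {red a b | a b. True}"
proof -
  have "carrier G = {0..<q} \<times> {0..<P}"
    by (simp add: modular_group_def q_def P_def)
  also have "\<dots> = {red a b | a b. True}"
  proof (intro equalityI subsetI)
    fix x assume "x \<in> {0..<q} \<times> {0..<P}"
    then have "x = red (fst x) (snd x)" by (auto simp: red_def)
    then show "x \<in> {red a b | a b. True}" by blast
  next
    fix x assume "x \<in> {red a b | a b. True}"
    then show "x \<in> {0..<q} \<times> {0..<P}"
      using q_pos P_gt_2 by (auto simp: red_def)
  qed
  finally show ?thesis .
qed

lemma red_in_carrier [simp]: "red a b \<in> carrier G"
  by (auto simp: carrier_eq)

lemma carrierE: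
  assumes "x \<in> carrier G"
  obtains a b where "x = red a b"
  using assms by (auto simp: carrier_eq)

lemma group_G: "group G"
proof (rule groupI)
  fix x y assume "x \<in> carrier G" "y \<in> carrier G"
  then show "x \<otimes>\<^bsub>G\<^esub> y \<in> carrier G" by (auto elim!: carrierE simp: red_mult)
next
  show "\<one>\<^bsub>G\<^esub> \<in> carrier G" by (simp add: one_eq)
next
  fix x y z assume "x \<in> carrier G" "y \<in> carrier G" "z \<in> carrier G"
  then obtain a b c d e f where *: "x = red a b" "y = red c d" "z = red e f"
    by (metis carrierE)
  \<comment> \<open>The two bracketings differ by a multiple of \<open>r * r\<close>.\<close>
  have "(a + c + r * b * c + e + r * (b + d) * e) - (a + (c + e + r * d * e) + r * b * (c + e + r * d * e))
      = (r * r) * (- b * d * e)" by (simp add: algebra_simps)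
  then have "q dvd (a + c + r * b * c + e + r * (b + d) * e) - (a + (c + e + r * d * e) + r * b * (c + e + r * d * e))"
    using q_dvd_rr by (metis dvd_mult2)
  then show "x \<otimes>\<^bsub>G\<^esub> y \<otimes>\<^bsub>G\<^esub> z = x \<otimes>\<^bsub>G\<^esub> (y \<otimes>\<^bsub>G\<^esub> z)"
    by (simp add: * red_mult red_eq_iff)
next
  fix x assume "x \<in> carrier G"
  then show "\<one>\<^bsub>G\<^esub> \<otimes>\<^bsub>G\<^esub> x = x" by (auto elim!: carrierE simp: red_mult one_eq)
next
  fix x assume "x \<in> carrier G"
  then obtain a b where x: "x = red a b" by (rule carrierE)
  \<comment> \<open>The summand \<open>r * a * b\<close> cancels the cocycle term of
    \<open>- b\<close> and \<open>a\<close>.\<close>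
  have "red (r * a * b - a) (- b) \<otimes>\<^bsub>G\<^esub> x = \<one>\<^bsub>G\<^esub>"
    by (simp add: x red_mult one_eq)
  then show "\<exists>y \<in> carrier G. y \<otimes>\<^bsub>G\<^esub> x = \<one>\<^bsub>G\<^esub>" by (rule bexI) simp
qed

sublocale group G by (rule group_G)

lemma inv_red: "inv\<^bsub>G\<^esub> red a b = red (r * a * b - a) (- b)"
  by (rule inv_equality) (simp_all add: red_mult one_eq)

text \<open>Conjugation fixes the second coordinate and moves the first by a multiple of
  \<open>r\<close>; normality of subgroups is read off from this.\<close>

lemma conj_red: "red c d \<otimes>\<^bsub>G\<^esub> red a b \<otimes>\<^bsub>G\<^esub> inv\<^bsub>G\<^esub> red c d = red (a + r * (d * a - b * c)) b"
proof -
  have "red c d \<otimes>\<^bsub>G\<^esub> red a b = red (a + r * (d * a - b * c)) b \<otimes>\<^bsub>G\<^esub> red c d"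
    by (simp add: red_mult red_eq_iff) (simp add: algebra_simps)
  then show ?thesis by (simp only:) (simp add: m_assoc)
qed

text \<open>The factor multiplied onto the \<open>k\<close>-th power adds the cocycle term
  \<open>r * (k * b) * a\<close>, and the numbers \<open>k < n\<close> sum to
  \<open>n choose 2\<close>.\<close>

lemma pow_red: "red a b [^]\<^bsub>G\<^esub> n = red (int n * a + r * a * b * int (n choose 2)) (int n * b)"
proof (induction n)
  case 0
  then show ?case by (simp add: one_eq binomial_eq_0)
next
  case (Suc n)
  have "int (Suc n choose 2) = int (n choose 2) + int n"
    by (simp add: numeral_2_eq_2)
  then show ?case
    by (simp add: Suc red_mult) (simp add: algebra_simps)
qed

text \<open>For an odd prime, \<open>p\<close> divides \<open>p choose 2\<close>, so the cocycle
  contribution is a multiple of \<open>r * P = q\<close>.\<close>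

lemma pow_p_red: "red a b [^]\<^bsub>G\<^esub> p = red (P * a) 0"
proof -
  have "p dvd p choose 2"
    using prime_p P_gt_2 by (intro dvd_choose_prime) (auto simp: P_def)
  then have "P dvd int (p choose 2)" by (simp add: P_def)
  then have "r * P dvd r * (int (p choose 2) * (a * b))"
    by (intro mult_dvd_mono dvd_refl dvd_mult2)
  then have "q dvd r * a * b * int (p choose 2)" by (simp add: q_eq mult_ac)
  then show ?thesis by (simp add: pow_red red_eq_iff P_def)
qed

lemma class_two_G: "class_two G"
  unfolding class_two_def
proof (intro ballI)
  fix x y assume "x \<in> carrier G" "y \<in> carrier G"
  then obtain a b c d where *: "x = red a b" "y = red c d"
    by (metis carrierE)
  show "\<exists>c \<in> carrier G. (\<forall>z \<in> carrier G. c \<otimes>\<^bsub>G\<^esub> z = z \<otimes>\<^bsub>G\<^esub> c) \<and> x \<otimes>\<^bsub>G\<^esub> y = c \<otimes>\<^bsub>G\<^esub> (y \<otimes>\<^bsub>G\<^esub> x)"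
  proof (intro bexI conjI ballI)
    \<comment> \<open>The commutator of \<open>x\<close> and \<open>y\<close>. It is central because
      it only meets the cocycle in a term with factor \<open>r * r\<close>.\<close>
    let ?c = "red (r * (b * c - d * a)) 0"
    show "?c \<in> carrier G" by simp
    show "x \<otimes>\<^bsub>G\<^esub> y = ?c \<otimes>\<^bsub>G\<^esub> (y \<otimes>\<^bsub>G\<^esub> x)"
      by (simp add: * red_mult red_eq_iff) (simp add: algebra_simps)
    fix z assume "z \<in> carrier G"
    then obtain e f where z: "z = red e f" by (rule carrierE)
    have "r * (b * c - d * a) + e - (e + r * (b * c - d * a) + r * f * (r * (b * c - d * a)))
        = r * r * (- f * (b * c - d * a))" by (simp add: algebra_simps)
    then have "q dvd r * (b * c - d * a) + e - (e + r * (b * c - d * a) + r * f * (r * (b * c - d * a)))"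
      using q_dvd_rr by (metis dvd_mult2)
    then show "?c \<otimes>\<^bsub>G\<^esub> z = z \<otimes>\<^bsub>G\<^esub> ?c"
      by (simp add: z red_mult red_eq_iff)
  qed
qed

lemma order_G: "order G = p ^ (m + 1)"
  by (simp add: order_def modular_group_def card_cartesian_product nat_power_eq)

lemma finite_carrier: "finite (carrier G)"
  by (simp add: modular_group_def)

end

section \<open>Classification of the subgroups of the modular group\<close>

lemma additive_subgroup_prime_power:
  fixes I :: "int set"
  assumes "prime p" "p ^ m \<in> I" "0 \<in> I" and diff: "\<And>a b. a \<in> I \<Longrightarrow> b \<in> I \<Longrightarrow> a - b \<in> I"
  obtains i where "i \<le> m" "I = {a. p ^ i dvd a}"
proof -
  have add: "a + b \<in> I" if "a \<in> I" "b \<in> I" for a b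
    using diff[OF that(1) diff[OF assms(3) that(2)]] by simp
  have mult: "k * a \<in> I" if "a \<in> I" for a k
    by (induction k rule: int_induct[of _ 0])
      (use that assms(3) add diff in \<open>auto simp: distrib_right left_diff_distrib\<close>)
  define i where "i = (LEAST i. p ^ i \<in> I)"
  have i: "p ^ i \<in> I" "i \<le> m"
    unfolding i_def by (rule LeastI, fact, rule Least_le, fact)
  have "p ^ i dvd a" if a: "a \<in> I" for a
  proof -
    \<comment> \<open>By Bezout the gcd with \<open>p ^ m\<close> lies in \<open>I\<close>. As a
      divisor of \<open>p ^ m\<close> it is a power of \<open>p\<close>, so minimality of
      \<open>i\<close> makes \<open>p ^ i\<close> divide it, and hence \<open>a\<close>.\<close>
    obtain u v where "u * a + v * p ^ m = gcd a (p ^ m)" by (metis bezout_int)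
    then have g: "gcd a (p ^ m) \<in> I" using add[OF mult[OF a] mult[OF assms(2)]] by metis
    obtain j where "gcd a (p ^ m) = p ^ j"
      using divides_primepow[OF assms(1), of "gcd a (p ^ m)" m] by (auto simp: prime_ge_0_int[OF assms(1)])
    then show ?thesis
      using g unfolding i_def by (metis Least_le dvd_trans gcd_dvd1 le_imp_power_dvd)
  qed
  then have "I = {a. p ^ i dvd a}"
    using mult[OF i(1)] by (auto elim!: dvdE simp: mult.commute)
  with i(2) show ?thesis by (rule that)
qed

context modular_p_group
begin

text \<open>\<open>U 0 t\<close> is the whole group, so the truncated subtraction in its definition is harmless;
  the non-normal subgroups turn out to be the \<open>U m t\<close>.\<close>

definition U :: "nat \<Rightarrow> int \<Rightarrow> (int \<times> int) set" where
  "U i t = {red a b | a b. P ^ i dvd a - t * P ^ (i - 1) * b}"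

text \<open>For \<open>i \<le> m\<close> these are the subgroups inside the first factor.
  \<open>U i t\<close> meets the first factor in \<open>K i\<close> but maps onto the second factor,
  with \<open>red (t * P ^ (i - 1)) 1\<close> above its generator.\<close>

definition K :: "nat \<Rightarrow> (int \<times> int) set" where
  "K i = {red a 0 | a. P ^ i dvd a}"

text \<open>The condition does not depend on the representatives: \<open>P ^ i\<close> divides
  \<open>q\<close>, and a multiple of \<open>P\<close> added to \<open>b\<close> is absorbed by the
  factor \<open>P ^ (i - 1)\<close>.\<close>

lemma red_in_U_iff:
  assumes "i \<le> m"
  shows "red a b \<in> U i t \<longleftrightarrow> P ^ i dvd a - t * P ^ (i - 1) * b"
proof
  assume "red a b \<in> U i t"
  then obtain c d where cd: "red a b = red c d" "P ^ i dvd c - t * P ^ (i - 1) * d"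
    unfolding U_def by blast
  then have "P ^ i dvd a - c" "P dvd b - d"
    using power_dvd_q[OF assms] by (auto simp: red_eq_iff intro: dvd_trans)
  moreover have "P ^ i dvd P ^ (i - 1) * P" by (cases i) auto
  ultimately have "P ^ i dvd a - c" "P ^ i dvd P ^ (i - 1) * (b - d)"
    by (auto intro: dvd_trans mult_dvd_mono)
  then have "P ^ i dvd (a - c) + (c - t * P ^ (i - 1) * d) - t * (P ^ (i - 1) * (b - d))"
    by (intro dvd_diff[OF dvd_add dvd_mult] cd(2))
  then show "P ^ i dvd a - t * P ^ (i - 1) * b" by (simp add: algebra_simps)
qed (auto simp: U_def)

lemma subgroup_U:
  assumes "i \<le> m"
  shows "subgroup (U i t) G"
proof (rule subgroupI)
  show "U i t \<subseteq> carrier G" by (auto simp: U_def)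
  show "U i t \<noteq> {}" using red_in_U_iff[OF assms, of 0 0 t] by auto
  \<comment> \<open>The condition is linear apart from the cocycle. It forces
    \<open>P ^ (i - 1)\<close> to divide \<open>a\<close>, and \<open>P\<close> divides
    \<open>r\<close>, so cocycle terms are harmless modulo \<open>P ^ i\<close>.\<close>
  have dvd: "P ^ i dvd r * b * a" if "P ^ i dvd a - t * P ^ (i - 1) * d" for a b d
  proof (cases i)
    case (Suc j)
    then have "P ^ j dvd a - t * P ^ (i - 1) * d"
      using that by (meson dvd_trans le_imp_power_dvd lessI less_imp_le)
    then have "P ^ j dvd a"
      using Suc by (metis diff_Suc_1 dvd_diff_right_iff dvd_mult dvd_mult2 dvd_refl dvd_diff_left_iff)
    then show ?thesis
      using mult_dvd_mono[OF P_dvd_r, of "P ^ j" a] Suc by (metis dvd_mult2 mult.assoc mult.commute power_Suc)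
  qed auto
  show "inv\<^bsub>G\<^esub> x \<in> U i t" if xU: "x \<in> U i t" for x
  proof -
    obtain a b where x: "x = red a b" "P ^ i dvd a - t * P ^ (i - 1) * b"
      using xU unfolding U_def by blast
    have "P ^ i dvd r * b * a - (a - t * P ^ (i - 1) * b)"
      by (rule dvd_diff[OF dvd[OF x(2)] x(2)])
    then show ?thesis by (simp add: x inv_red red_in_U_iff assms algebra_simps)
  qed
  show "x \<otimes>\<^bsub>G\<^esub> y \<in> U i t" if xU: "x \<in> U i t" and yU: "y \<in> U i t" for x y
  proof -
    obtain a b where x: "x = red a b" "P ^ i dvd a - t * P ^ (i - 1) * b"
      using xU unfolding U_def by blast
    obtain c d where y: "y = red c d" "P ^ i dvd c - t * P ^ (i - 1) * d"
      using yU unfolding U_def by blast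
    have "P ^ i dvd (a - t * P ^ (i - 1) * b) + (c - t * P ^ (i - 1) * d) + r * b * c"
      by (rule dvd_add[OF dvd_add[OF x(2) y(2)] dvd[OF y(2)]])
    then show ?thesis by (simp add: x y red_mult red_in_U_iff assms algebra_simps)
  qed
qed

text \<open>On the first factor the cocycle vanishes, so the integers \<open>a\<close> with
  \<open>red a 0\<close> in \<open>H\<close> form an additive group containing
  \<open>P ^ m\<close>.\<close>

lemma subgroup_kernel:
  assumes "subgroup H G"
  obtains i where "i \<le> m" "\<forall>a. red a 0 \<in> H \<longleftrightarrow> P ^ i dvd a"
proof -
  interpret H: subgroup H G by fact
  have "red 0 0 \<in> H" using H.one_closed by (simp add: one_eq)
  moreover have "red (P ^ m) 0 = red 0 0" by (simp add: red_eq_iff q_def)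
  moreover have "red (a - b) 0 \<in> H" if "red a 0 \<in> H" "red b 0 \<in> H" for a b
    using H.m_closed[OF that(1) H.m_inv_closed[OF that(2)]] by (simp add: inv_red red_mult)
  ultimately obtain i where "i \<le> m" "{a. red a 0 \<in> H} = {a. P ^ i dvd a}"
    using additive_subgroup_prime_power[OF P_prime, of m "{a. red a 0 \<in> H}"] by (metis mem_Collect_eq)
  then show ?thesis by (intro that[of i]) auto
qed

text \<open>A subgroup mapping onto the second factor is determined by its intersection with the
  first factor and one element above the generator of the second factor.\<close>

lemma subgroup_subsetI:
  assumes "subgroup H G" "subgroup H' G" "red s 1 \<in> H" "red s 1 \<in> H'"
    and kernel: "\<And>a. red a 0 \<in> H \<Longrightarrow> red a 0 \<in> H'"
  shows "H \<subseteq> H'"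
proof
  interpret H: subgroup H G by fact
  interpret H': subgroup H' G by fact
  fix x assume x: "x \<in> H"
  then obtain a b where ab: "x = red a b" using H.subset carrierE by blast
  \<comment> \<open>An element of both subgroups with the same second coordinate as
    \<open>x\<close>; the quotient of \<open>x\<close> by it lies in the first factor.\<close>
  define y where "y = red s 1 [^]\<^bsub>G\<^esub> nat (b mod P)"
  have y: "y \<in> H" "y \<in> H'"
    using assms(3,4) by (simp_all add: y_def subgroup_nat_pow_closed assms)
  have "b mod P \<ge> 0" using P_gt_2 by simp
  then obtain c where c: "y = red c (b mod P)" by (auto simp: y_def pow_red)
  have "x \<otimes>\<^bsub>G\<^esub> inv\<^bsub>G\<^esub> y = red (a + (r * c * (b mod P) - c) + r * b * (r * c * (b mod P) - c)) (b - b mod P)"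
    by (simp add: ab c inv_red red_mult)
  also have "\<dots> = red (a + (r * c * (b mod P) - c) + r * b * (r * c * (b mod P) - c)) 0"
    by (simp add: red_eq_iff)
  finally have "x \<otimes>\<^bsub>G\<^esub> inv\<^bsub>G\<^esub> y \<in> H'"
    using kernel H.m_closed[OF x H.m_inv_closed[OF y(1)]] by metis
  then have "x \<otimes>\<^bsub>G\<^esub> inv\<^bsub>G\<^esub> y \<otimes>\<^bsub>G\<^esub> y \<in> H'" using y(2) by (rule H'.m_closed)
  then show "x \<in> H'" using x y by (simp add: m_assoc)
qed

text \<open>The image in the second factor, of prime order, is either trivial or everything; this
  gives the two families.\<close>

lemma subgroup_cases:
  assumes "subgroup H G"
  obtains i where "i \<le> m" "H = K i" | i t where "i \<le> m" "H = U i t"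
proof -
  interpret H: subgroup H G by fact
  obtain i where i: "i \<le> m" "\<forall>a. red a 0 \<in> H \<longleftrightarrow> P ^ i dvd a"
    by (rule subgroup_kernel[OF assms])
  show ?thesis
  proof (cases "\<forall>a b. red a b \<in> H \<longrightarrow> P dvd b")
    case True
    have "x \<in> K i" if x: "x \<in> H" for x
    proof -
      obtain a b where ab: "x = red a b" using H.mem_carrier[OF x] by (rule carrierE)
      then have "P dvd b" using True x by blast
      then have "x = red a 0" by (simp add: ab red_eq_iff)
      then show ?thesis using x i(2) unfolding K_def by blast
    qed
    then have "H = K i" using i(2) unfolding K_def by blast
    then show ?thesis using that(1) i(1) by blast
  next
    case False
    then obtain a b where ab: "red a b \<in> H" "\<not> P dvd b" by blast
    then have "coprime b P" using P_prime by (metis coprime_commute prime_imp_coprime)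
    then obtain x where x: "[b * x = 1] (mod P)" using cong_solve_coprime_int by blast
    \<comment> \<open>An inverse of \<open>b\<close> modulo \<open>P\<close>: the
      \<open>n\<close>-th power has second coordinate 1.\<close>
    define n where "n = nat (x mod P)"
    have "int n = x mod P" using P_gt_2 by (simp add: n_def)
    then have "[int n * b = 1] (mod P)" using x by (simp add: cong_def mod_simps mult.commute)
    then have "P dvd int n * b - 1" by (simp add: cong_iff_dvd_diff)
    then have "red a b [^]\<^bsub>G\<^esub> n = red (int n * a + r * a * b * int (n choose 2)) 1"
      by (simp add: pow_red red_eq_iff)
    then obtain s where s: "red s 1 \<in> H"
      using subgroup_nat_pow_closed[OF assms ab(1), of n] by metis
    \<comment> \<open>The \<open>p\<close>-th power falls into the first factor, so
      \<open>P ^ i\<close> divides \<open>P * s\<close>. This gives \<open>s\<close> the form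
      required in \<open>U i t\<close> and yields \<open>t\<close>.\<close>
    have "red (P * s) 0 \<in> H"
      using subgroup_nat_pow_closed[OF assms s, of p] by (simp add: pow_p_red)
    then have "P ^ i dvd P * s" by (simp add: i)
    then have "P ^ (i - 1) dvd s" using P_gt_2 by (cases i) auto
    then obtain t where t: "s = P ^ (i - 1) * t" by (rule dvdE)
    have "red s 1 \<in> U i t" by (simp add: red_in_U_iff i t)
    moreover have "red a 0 \<in> H \<longleftrightarrow> red a 0 \<in> U i t" for a
      by (simp add: red_in_U_iff i)
    ultimately have "H = U i t"
      using s subgroup_subsetI[OF assms subgroup_U[OF i(1)]]
        subgroup_subsetI[OF subgroup_U[OF i(1)] assms] by (metis subset_antisym)
    then show ?thesis using that(2) i(1) by blast
  qed
qed

lemma U_mod: "i \<le> m \<Longrightarrow> U i (t mod P) = U i t"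
proof -
  assume i: "i \<le> m"
  have *: "P ^ i dvd P ^ (i - 1) * (t - t mod P) * b" for b
    by (cases i) (auto intro!: mult_dvd_mono dvd_mult2 simp: mult.commute[of P])
  have "P ^ i dvd a - (t mod P) * P ^ (i - 1) * b \<longleftrightarrow> P ^ i dvd a - t * P ^ (i - 1) * b" for a b
  proof -
    have "a - (t mod P) * P ^ (i - 1) * b = (a - t * P ^ (i - 1) * b) + P ^ (i - 1) * (t - t mod P) * b"
      by (simp add: algebra_simps)
    then show ?thesis using * by (metis dvd_add_left_iff)
  qed
  then show ?thesis by (simp add: U_def)
qed

text \<open>The intersection with the first factor recovers \<open>i\<close>, and the elements above
  1 recover \<open>t\<close> modulo \<open>P\<close>. The index 0 is left out because
  \<open>U 0 t\<close> is the whole group for every \<open>t\<close>.\<close>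

lemma inj_U: "inj_on (\<lambda>(i, t). U i t) ({1..m} \<times> {0..<P})"
proof (rule inj_onI, clarify)
  fix i j t u assume ij: "i \<in> {1..m}" "j \<in> {1..m}" and tu: "t \<in> {0..<P}" "u \<in> {0..<P}" and eq: "U i t = U j u"
  have iff: "P ^ i dvd a \<longleftrightarrow> P ^ j dvd a" for a
    using red_in_U_iff[of i a 0 t] red_in_U_iff[of j a 0 u] eq ij by simp
  have "P ^ i dvd P ^ j" "P ^ j dvd P ^ i"
    using iff[of "P ^ j"] iff[of "P ^ i"] by simp_all
  then have "P ^ j = P ^ i"
    using P_gt_2 by (intro zdvd_antisym_nonneg) auto
  then have [simp]: "j = i" using P_gt_2 by (simp add: power_inject_exp)
  have "red (t * P ^ (i - 1)) 1 \<in> U i u"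
    using red_in_U_iff[of i "t * P ^ (i - 1)" 1 t] eq ij by simp
  then have "P ^ i dvd P ^ (i - 1) * (t - u)"
    using red_in_U_iff[of i "t * P ^ (i - 1)" 1 u] ij by (simp add: algebra_simps)
  moreover have "P ^ i = P ^ (i - 1) * P" using ij power_minus_mult[of i P] by simp
  ultimately have "P dvd t - u" using P_gt_2 by (simp only: dvd_mult_cancel_left) simp
  then have "t mod P = u mod P" by (simp only: mod_eq_dvd_iff)
  then have "t = u" using tu by simp
  then show "i = j \<and> t = u" by simp
qed

section \<open>Counting subgroups and conjugacy classes\<close>

lemma card_subgroup_lattice_lower: "m * p \<le> card (subgroup_lattice G)"
proof -
  have "(\<lambda>(i, t). U i t) ` ({1..m} \<times> {0..<P}) \<subseteq> subgroup_lattice G"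
    by (auto simp: subgroup_lattice_def subgroup_U)
  from card_mono[OF finite_subgroup_lattice[OF finite_carrier] this] show ?thesis
    by (subst (asm) card_image[OF inj_U]) (simp add: card_cartesian_product P_def)
qed

text \<open>At most \<open>m + 1\<close> subgroups \<open>K i\<close> and \<open>(m + 1) * p\<close>
  subgroups \<open>U i t\<close>. The whole group is counted \<open>p\<close> times, which the
  estimate of \<open>d'\<close> tolerates.\<close>

lemma card_subgroup_lattice_upper: "card (subgroup_lattice G) \<le> (m + 1) * (p + 1)"
proof -
  let ?K = "K ` {..m}" and ?U = "(\<lambda>(i, t). U i t) ` ({..m} \<times> {0..<P})"
  have "subgroup_lattice G \<subseteq> ?K \<union> ?U"
  proof
    fix H assume "H \<in> subgroup_lattice G"
    then have "subgroup H G" by (simp add: subgroup_lattice_def)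
    then show "H \<in> ?K \<union> ?U"
    proof (cases rule: subgroup_cases)
      case (2 i t)
      then have "H = (\<lambda>(i, t). U i t) (i, t mod P)" by (simp add: U_mod)
      moreover have "(i, t mod P) \<in> {..m} \<times> {0..<P}" using 2 P_gt_2 by simp
      ultimately show ?thesis by blast
    qed auto
  qed
  then have "card (subgroup_lattice G) \<le> card (?K \<union> ?U)" by (intro card_mono) auto
  also have "\<dots> \<le> card ?K + card ?U" by (rule card_Un_le)
  also have "\<dots> \<le> card {..m} + card ({..m} \<times> {0..<P})" by (intro add_mono card_image_le) auto
  also have "\<dots> = (m + 1) * (p + 1)" by (simp add: card_cartesian_product P_def)
  finally show ?thesis .
qed

text \<open>Conjugation by \<open>red c d\<close> shifts the parameter \<open>t\<close> to
  \<open>t - c\<close>, and \<open>c\<close> is arbitrary.\<close>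

lemma conj_class_U: "conj_class G (U m t) = range (U m)"
proof -
  have conj: "(\<lambda>x. red c d \<otimes>\<^bsub>G\<^esub> x \<otimes>\<^bsub>G\<^esub> inv\<^bsub>G\<^esub> red c d) ` U m t = U m (t - c)" for c d
  proof (intro equalityI subsetI)
    have U: "red a b \<in> U m s \<longleftrightarrow> q dvd a - s * r * b" for a b s
      by (simp add: red_in_U_iff q_def r_def)
    fix x assume "x \<in> (\<lambda>x. red c d \<otimes>\<^bsub>G\<^esub> x \<otimes>\<^bsub>G\<^esub> inv\<^bsub>G\<^esub> red c d) ` U m t"
    then obtain a b where x: "x = red (a + r * (d * a - b * c)) b" "q dvd a - t * r * b"
      by (auto simp: U_def conj_red q_def r_def)
    have "a + r * (d * a - b * c) - (t - c) * r * b = (a - t * r * b) * (1 + r * d) + r * r * (t * b * d)"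
      by (simp add: algebra_simps)
    also have "q dvd \<dots>" by (rule dvd_add[OF dvd_mult2[OF x(2)] dvd_mult2[OF q_dvd_rr]])
    finally show "x \<in> U m (t - c)" by (simp add: x U)
  next
    have U: "red a b \<in> U m s \<longleftrightarrow> q dvd a - s * r * b" for a b s
      by (simp add: red_in_U_iff q_def r_def)
    fix x assume "x \<in> U m (t - c)"
    then obtain a b where x: "x = red a b" "q dvd a - (t - c) * r * b"
      by (auto simp: U_def q_def r_def)
    \<comment> \<open>First coordinate, modulo \<open>q\<close>, of \<open>x\<close> conjugated by
      the inverse of \<open>red c d\<close>.\<close>
    define a' where "a' = a + r * b * c - r * d * a"
    have "a' - t * r * b = (a - (t - c) * r * b) * (1 - r * d) - r * r * ((t - c) * b * d)"
      unfolding a'_def by (simp add: algebra_simps)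
    also have "q dvd \<dots>" by (rule dvd_diff[OF dvd_mult2[OF x(2)] dvd_mult2[OF q_dvd_rr]])
    finally have "red a' b \<in> U m t" by (simp add: U)
    moreover have "red c d \<otimes>\<^bsub>G\<^esub> red a' b \<otimes>\<^bsub>G\<^esub> inv\<^bsub>G\<^esub> red c d = x"
    proof -
      have "a' + r * (d * a' - b * c) - a = r * r * (d * (b * c - d * a))"
        unfolding a'_def by (simp add: algebra_simps)
      also have "q dvd \<dots>" using q_dvd_rr by (rule dvd_mult2)
      finally show ?thesis by (simp add: x conj_red red_eq_iff)
    qed
    ultimately show "x \<in> (\<lambda>x. red c d \<otimes>\<^bsub>G\<^esub> x \<otimes>\<^bsub>G\<^esub> inv\<^bsub>G\<^esub> red c d) ` U m t"
      by (metis (no_types, lifting) image_eqI)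
  qed
  show ?thesis
  proof (intro equalityI subsetI)
    fix X assume "X \<in> conj_class G (U m t)"
    then show "X \<in> range (U m)"
      by (auto simp: conj_class_def conj elim!: carrierE)
  next
    fix X assume "X \<in> range (U m)"
    then obtain u where "X = U m (t - (t - u))" by auto
    then show "X \<in> conj_class G (U m t)"
      unfolding conj_class_def conj[of "t - u" 0, symmetric] by (intro image_eqI[where x = "red (t - u) 0"]) auto
  qed
qed

text \<open>For \<open>U i t\<close> with \<open>i < m\<close>, conjugation changes the first
  coordinate by a multiple of \<open>r\<close>, hence of \<open>P ^ i\<close>. For
  \<open>K i\<close> it changes \<open>a\<close> by a multiple of \<open>a\<close> itself.\<close>

lemma conj_class_normal:
  assumes "subgroup H G" "H \<notin> range (U m)"
  shows "conj_class G H = {H}"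
proof -
  interpret H: subgroup H G by fact
  have closed: "g \<otimes>\<^bsub>G\<^esub> x \<otimes>\<^bsub>G\<^esub> inv\<^bsub>G\<^esub> g \<in> H" if x: "x \<in> H" and g: "g \<in> carrier G" for x g
  proof -
    obtain c d where g: "g = red c d" using g by (rule carrierE)
    from assms(1) show ?thesis
    proof (cases rule: subgroup_cases)
      case (1 i)
      then obtain a where a: "x = red a 0" "P ^ i dvd a" using x by (auto simp: K_def)
      then have "P ^ i dvd a + r * (d * a)" by simp
      then show ?thesis using 1 by (auto simp: a g conj_red K_def)
    next
      case (2 i t)
      then have "i < m" using assms(2) by (auto simp: order_le_less)
      obtain a b where a: "x = red a b" "P ^ i dvd a - t * P ^ (i - 1) * b"
        using x 2 unfolding U_def by blast
      then have "P ^ i dvd (a - t * P ^ (i - 1) * b) + r * (d * a - b * c)"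
        using power_dvd_r[OF \<open>i < m\<close>] by (intro dvd_add dvd_mult2)
      then show ?thesis using 2 by (simp add: a g conj_red red_in_U_iff algebra_simps)
    qed
  qed
  have "(\<lambda>x. g \<otimes>\<^bsub>G\<^esub> x \<otimes>\<^bsub>G\<^esub> inv\<^bsub>G\<^esub> g) ` H = H" if g: "g \<in> carrier G" for g
  proof
    show "(\<lambda>x. g \<otimes>\<^bsub>G\<^esub> x \<otimes>\<^bsub>G\<^esub> inv\<^bsub>G\<^esub> g) ` H \<subseteq> H" using closed g by blast
    show "H \<subseteq> (\<lambda>x. g \<otimes>\<^bsub>G\<^esub> x \<otimes>\<^bsub>G\<^esub> inv\<^bsub>G\<^esub> g) ` H"
    proof
      fix x assume x: "x \<in> H"
      have "x = g \<otimes>\<^bsub>G\<^esub> (inv\<^bsub>G\<^esub> g \<otimes>\<^bsub>G\<^esub> x \<otimes>\<^bsub>G\<^esub> inv\<^bsub>G\<^esub> (inv\<^bsub>G\<^esub> g)) \<otimes>\<^bsub>G\<^esub> inv\<^bsub>G\<^esub> g"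
        using x g by (simp add: m_assoc) (simp flip: m_assoc)
      then show "x \<in> (\<lambda>x. g \<otimes>\<^bsub>G\<^esub> x \<otimes>\<^bsub>G\<^esub> inv\<^bsub>G\<^esub> g) ` H"
        using closed[OF x, of "inv\<^bsub>G\<^esub> g"] g by (intro image_eqI) auto
    qed
  qed
  then have "conj_class G H = (\<lambda>g. H) ` carrier G"
    unfolding conj_class_def by (intro image_cong refl)
  then show ?thesis using one_closed by auto
qed

lemma card_range_U: "card (range (U m)) = p"
proof -
  have "range (U m) = (\<lambda>(i, t). U i t) ` ({m} \<times> {0..<P})"
  proof (intro equalityI subsetI)
    fix X assume "X \<in> range (U m)"
    then obtain t where "X = U m (t mod P)" by (auto simp: U_mod)
    then show "X \<in> (\<lambda>(i, t). U i t) ` ({m} \<times> {0..<P})"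
      using P_gt_2 by (intro image_eqI[where x = "(m, t mod P)"]) auto
  qed auto
  moreover have "inj_on (\<lambda>(i, t). U i t) ({m} \<times> {0..<P})"
    by (rule inj_on_subset[OF inj_U]) (use m_ge_2 in auto)
  ultimately show ?thesis by (simp add: card_image P_def card_cartesian_product)
qed

text \<open>The \<open>p\<close> subgroups \<open>U m t\<close> form a single class and every other
  subgroup is a class by itself. The additive form avoids truncated subtraction.\<close>

lemma k'_G: "k' G + p = card (subgroup_lattice G) + 1"
proof -
  let ?L = "subgroup_lattice G" and ?N = "range (U m)"
  have fin: "finite ?L" by (rule finite_subgroup_lattice[OF finite_carrier])
  have sub: "?N \<subseteq> ?L" by (auto simp: subgroup_lattice_def subgroup_U)
  have "subgroup_classes G = conj_class G ` (?L - ?N) \<union> conj_class G ` ?N"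
    using sub unfolding subgroup_classes_eq by blast
  also have "conj_class G ` (?L - ?N) = (\<lambda>H. {H}) ` (?L - ?N)"
    by (intro image_cong refl conj_class_normal) (auto simp: subgroup_lattice_def)
  also have "conj_class G ` ?N = {?N}"
    unfolding image_image conj_class_U by simp
  finally have "k' G = card ((\<lambda>H. {H}) ` (?L - ?N) \<union> {?N})"
    by (simp add: k'_def)
  also have "\<dots> = card ((\<lambda>H. {H}) ` (?L - ?N)) + 1"
  proof -
    \<comment> \<open>If \<open>?N\<close> were \<open>{H}\<close>, then \<open>H\<close> would lie
      in \<open>?N\<close>, against the choice of \<open>H\<close>.\<close>
    have "?N \<notin> (\<lambda>H. {H}) ` (?L - ?N)"
      by blast
    then show ?thesis using fin by simp
  qed
  also have "card ((\<lambda>H. {H}) ` (?L - ?N)) = card (?L - ?N)"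
    by (rule card_image) simp
  also have "\<dots> = card ?L - p"
    using sub fin by (simp add: card_Diff_subset finite_subset card_range_U)
  finally show ?thesis
    using card_mono[OF fin sub] card_range_U by simp
qed

lemma d'_G:
  "d' G \<ge> 1 - 1 / real m" "d' G \<le> 1 - 1 / (2 * (real m + 1))"
proof -
  define l where "l = real (card (subgroup_lattice G))"
  have p3: "real p \<ge> 3" using P_gt_2 by (simp add: P_def)
  have lower: "real m * real p \<le> l"
    using card_subgroup_lattice_lower unfolding l_def by (metis of_nat_le_iff of_nat_mult)
  have upper: "l \<le> (real m + 1) * (real p + 1)"
    using of_nat_mono[OF card_subgroup_lattice_upper, where 'a = real] unfolding l_def
    by (simp add: algebra_simps)
  have m: "real m \<ge> 2" using m_ge_2 by simp
  have "real m * real p > 0" using m p3 by simp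
  then have l: "l > 0" using lower by linarith
  have "real (k' G) = l - (real p - 1)"
    using k'_G unfolding l_def by linarith
  then have d: "d' G = 1 - (real p - 1) / l"
    using l by (simp add: d'_def l_def[symmetric] field_simps)
  have "(real p - 1) / l \<le> 1 / real m"
    using l m lower by (simp add: field_simps)
  then show "d' G \<ge> 1 - 1 / real m" by (simp add: d)
  \<comment> \<open>From \<open>p \<ge> 3\<close> follows \<open>p + 1 \<le> 2 * (p - 1)\<close>,
    which removes \<open>p\<close> from the bound.\<close>
  have "(real m + 1) * (real p + 1) \<le> (real m + 1) * (2 * (real p - 1))"
    using p3 by (intro mult_left_mono) auto
  with upper have "l \<le> (real m + 1) * (2 * (real p - 1))" by (rule order_trans)
  also have "\<dots> = (real p - 1) * (2 * (real m + 1))" by (simp add: algebra_simps)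
  finally have "l \<le> (real p - 1) * (2 * (real m + 1))" .
  then have "1 / (2 * (real m + 1)) \<le> (real p - 1) / l"
    using l m by (simp add: field_simps)
  then show "d' G \<le> 1 - 1 / (2 * (real m + 1))" by (simp add: d)
qed

end

section \<open>Density\<close>

text \<open>Each factor lowers the partial product by at most \<open>e\<close>, while the uniform
  bound \<open>c < 1\<close> forces the products to 0. So the first one below \<open>x + e\<close>
  cannot lie far below \<open>x\<close>.\<close>

lemma finite_products_dense:
  fixes f :: "nat \<Rightarrow> real"
  assumes e: "0 < e" and c: "0 \<le> c" "c < 1"
    and f: "\<And>n. 1 - e \<le> f n" "\<And>n. f n \<le> c" "\<And>n. 0 \<le> f n"
    and x: "0 \<le> x" "x \<le> 1"
  shows "\<exists>n. \<bar>(\<Prod>i<n. f i) - x\<bar> < 2 * e"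
proof -
  define g where "g n = (\<Prod>i<n. f i)" for n
  have g0: "g 0 = 1" and gS: "g (Suc n) = g n * f n" for n
    by (simp_all add: g_def)
  have g_nonneg: "g n \<ge> 0" for n
    unfolding g_def using f(3) by (intro prod_nonneg) auto
  have g_le: "g n \<le> 1" for n
    unfolding g_def by (intro prod_le_1 conjI f(3) order_trans[OF f(2) less_imp_le[OF c(2)]])
  have "g n \<le> c ^ n" for n
  proof (induction n)
    case (Suc n)
    have "g (Suc n) \<le> c ^ n * c"
      unfolding gS using Suc by (intro mult_mono f zero_le_power c(1))
    then show ?case by (simp add: mult.commute)
  qed (simp add: g0)
  moreover obtain n where "c ^ n < e"
    using real_arch_pow_inv[OF e c(2)] by blast
  ultimately have "g n < e" by (rule le_less_trans)
  then have "g n < x + e" using x by linarith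
  define k where "k = (LEAST n. g n < x + e)"
  have k: "g k < x + e" unfolding k_def by (rule LeastI) fact
  have "x - e \<le> g k"
  proof (cases k)
    \<comment> \<open>The empty product is 1, which is at least \<open>x\<close>.\<close>
    case 0
    then show ?thesis using g0 x e by simp
  next
    case (Suc j)
    then have "\<not> g j < x + e" unfolding k_def by (intro not_less_Least) simp
    moreover have "g j - g k = g j * (1 - f j)" by (simp add: Suc gS algebra_simps)
    moreover have "g j * (1 - f j) \<le> 1 * e"
      using f(1)[of j] f(2)[of j] c by (intro mult_mono g_le) auto
    ultimately show ?thesis using e by linarith
  qed
  with k e have "\<bar>g k - x\<bar> < 2 * e" by (simp add: abs_less_iff)
  then show ?thesis unfolding g_def by blast
qed

section \<open>Realising the products by groups of natural numbers\<close>

lemma trivial_nat_group: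
  obtains G :: "nat monoid" where "group G" "finite (carrier G)" "class_two G" "order G = 1" "d' G = 1"
proof
  let ?G = "\<lparr>carrier = {0}, mult = (\<lambda>_ _. 0), one = 0\<rparr> :: nat monoid"
  show G: "group ?G" by (rule groupI) auto
  show "finite (carrier ?G)" "order ?G = 1" by (simp_all add: order_def)
  show "class_two ?G" by (simp add: class_two_def)
  have "H = {0}" if "subgroup H ?G" for H
    using subgroup.subset[OF that] subgroup.one_closed[OF that] by auto
  moreover have "subgroup {0} ?G"
    using group.triv_subgroup[OF G] by simp
  ultimately have "subgroup_lattice ?G = {{0}}"
    unfolding subgroup_lattice_def by blast
  then show "d' ?G = 1"
    by (simp add: d'_def k'_def subgroup_classes_eq)
qed

text \<open>Induction on the set of primes. The order is carried along to keep the next modular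
  group coprime to the product so far, and \<open>class_two\<close> to obtain nilpotency at the
  end.\<close>

lemma product_of_modular_groups:
  assumes "m \<ge> 2" "finite S" "\<And>p. p \<in> S \<Longrightarrow> prime p \<and> odd p"
  shows "\<exists>G :: nat monoid. group G \<and> finite (carrier G) \<and> class_two G \<and>
    order G = (\<Prod>p\<in>S. p ^ (m + 1)) \<and> d' G = (\<Prod>p\<in>S. d' (modular_group p m))"
  using assms(2,3)
proof (induction S)
  case empty
  show ?case by (rule trivial_nat_group) auto
next
  case (insert p S)
  then obtain H :: "nat monoid" where H: "group H" "finite (carrier H)" "class_two H"
    "order H = (\<Prod>p\<in>S. p ^ (m + 1))" "d' H = (\<Prod>p\<in>S. d' (modular_group p m))"
    by auto
  interpret M: modular_p_group p m
    using insert.prems[of p] assms(1) by unfold_locales auto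
  let ?M = "modular_group p m"
  have "coprime (p ^ (m + 1)) (r ^ (m + 1))" if "r \<in> S" for r
    using insert.prems[of p] insert.prems[of r] insert.hyps that by (auto intro!: primes_coprime)
  then have cop: "coprime (order ?M) (order H)"
    unfolding H(4) M.order_G by (rule prod_coprime_right)
  have grp: "group (?M \<times>\<times> H)" by (rule DirProd_group[OF M.group_G H(1)])
  have fin: "finite (carrier (?M \<times>\<times> H))" using M.finite_carrier H(2) by simp
  obtain N :: "nat monoid" where N: "group N" "finite (carrier N)" "class_two N"
    "order N = order (?M \<times>\<times> H)" "d' N = d' (?M \<times>\<times> H)"
    using class_two_nat_copy[OF grp fin class_two_DirProd[OF M.class_two_G H(3)]] .
  have "order N = order ?M * order H"
    unfolding N(4) by (simp add: order_def card_cartesian_product)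
  moreover have "d' N = d' ?M * d' H"
    unfolding N(5) by (rule d'_DirProd_coprime[OF M.group_G H(1) M.finite_carrier H(2) cop])
  ultimately show ?case
    using N(1-3) insert.hyps by (intro exI[of _ N]) (simp add: H(4,5) M.order_G)
qed

theorem theoremA:
  shows "dense_in_set {d' G | G. G \<in> finite_nilpotent_groups} {0..1}"
  unfolding dense_in_set_def
proof (intro conjI subsetI)
  fix x assume "x \<in> {d' G | G. G \<in> finite_nilpotent_groups}"
  then show "x \<in> {0..1}" using d'_bounds by (auto simp: finite_nilpotent_groups_def)
next
  fix x :: real assume x: "x \<in> {0..1}"
  show "x \<in> closure {d' G | G. G \<in> finite_nilpotent_groups}"
    unfolding closure_approachable
  proof (intro allI impI)
    fix e :: real assume e: "e > 0"
    obtain k :: nat where k: "2 / e < real k" using reals_Archimedean2 by blast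
    \<comment> \<open>Large enough for steps of size \<open>1 / m\<close> to approximate within
      \<open>e\<close>; the added 2 secures \<open>m \<ge> 2\<close>.\<close>
    define m where "m = k + 2"
    have m: "m \<ge> 2" "2 / e < real m" using k by (simp_all add: m_def)
    then have me: "2 * (1 / real m) < e" using e by (simp add: field_simps)
    define Q where "Q = {p :: nat. prime p \<and> odd p}"
    have "{p :: nat. prime p} \<subseteq> insert 2 Q"
    proof
      fix p :: nat assume "p \<in> {p. prime p}"
      then show "p \<in> insert 2 Q"
        using primes_dvd_imp_eq[of 2 p] by (auto simp: Q_def)
    qed
    then have inf: "infinite Q"
      using primes_infinite finite_subset[of "{p :: nat. prime p}" "insert 2 Q"] by auto
    define f where "f n = d' (modular_group (enumerate Q n) m)" for n
    have f: "1 - 1 / real m \<le> f n" "f n \<le> 1 - 1 / (2 * (real m + 1))" for n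
    proof -
      interpret modular_p_group "enumerate Q n" m
        using enumerate_in_set[OF inf, of n] m(1) by unfold_locales (auto simp: Q_def)
      show "1 - 1 / real m \<le> f n" "f n \<le> 1 - 1 / (2 * (real m + 1))"
        unfolding f_def by (rule d'_G)+
    qed
    have "0 \<le> 1 - 1 / real m" using m(1) by simp
    then have f0: "0 \<le> f n" for n
      using f(1)[of n] by (rule order_trans)
    \<comment> \<open>The upper bound on \<open>f n\<close> depends on \<open>m\<close> alone, so it
      serves as the constant below 1 that drives the products to 0.\<close>
    have "0 < 1 / real m" "0 \<le> 1 - 1 / (2 * (real m + 1))" "1 - 1 / (2 * (real m + 1)) < 1"
      using m(1) by simp_all
    from finite_products_dense[OF this f f0] x
    obtain n where n: "\<bar>(\<Prod>i<n. f i) - x\<bar> < 2 * (1 / real m)"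
      by (meson atLeastAtMost_iff)
    let ?S = "enumerate Q ` {..<n}"
    have "finite ?S" "\<And>p. p \<in> ?S \<Longrightarrow> prime p \<and> odd p"
      using enumerate_in_set[OF inf] by (auto simp: Q_def)
    from product_of_modular_groups[OF m(1) this]
    obtain G :: "nat monoid" where G: "group G" "finite (carrier G)" "class_two G"
      "d' G = (\<Prod>p\<in>?S. d' (modular_group p m))"
      by blast
    \<comment> \<open>Distinct indices give distinct primes, so the product over the set of primes
      is the partial product of \<open>f\<close>.\<close>
    have "inj_on (enumerate Q) {..<n}"
      using inj_enumerate[OF inf] by (rule inj_on_subset) simp
    then have "d' G = (\<Prod>i<n. f i)"
      by (simp add: G(4) prod.reindex f_def)
    then have "dist (d' G) x < e" using n me by (simp add: dist_real_def)
    moreover have "G \<in> finite_nilpotent_groups"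
      using G class_two_imp_nilpotent by (simp add: finite_nilpotent_groups_def)
    ultimately show "\<exists>y \<in> {d' G | G. G \<in> finite_nilpotent_groups}. dist y x < e" by blast
  qed
qed

end
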